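(* For every $\varepsilon>0$ there exists a prime $p_\varepsilon$ such that for all primes $p\ge p_\varepsilon$, all integers $N\ge 1$ and every $\alpha\in\mathscr B(p,N)$, \[ \frac{1}{\#\mathcal V(p,N)^2}\,\#\Big\{(\beta_1,\beta_2)\in\mathcal V(p,N)^2:\ \big|\mathfrak d_{p,N}(\alpha,\beta_1)-\mathfrak d_{p,N}(\alpha,\beta_2)\big|\le\varepsilon\Big\}\ \ge\ 1-\varepsilon . \]
   Context: Let $p$ be an odd prime, $\omega=\exp(2\pi i/p)$, and $\mathbb{Q}(\omega)$ the $p$-th cyclotomic field, with $\mathbb{Q}$-basis $\omega,\omega^2,\dots,\omega^{p-1}$. For $\gamma\in\mathbb{Q}(\omega)$, $\mathrm{Tr}(\gamma)=\sum_{\sigma\in\mathrm{Gal}(\mathbb{Q}(\omega)/\mathbb{Q})}\sigma(\gamma)$. Let $\psi(\gamma)=(\mathrm{Tr}(\gamma\omega),\dots,\mathrm{Tr}(\gamma\omega^{p-1}))\in\mathbb{Q}^{p-1}$, let $\|\gamma\|$ be the Euclidean norm of $\psi(\gamma)$, and let $d(\alpha,\beta)=\|\beta-\alpha\|$. The normalized distance is $\mathfrak d_{p,N}(\alpha,\beta)=d(\alpha,\beta)/(2Np(p-1)^{1/2})$ (this denominator is the diameter of $\mathscr B(p,N)$ for $d$). For an integer $N\ge1$, $\mathscr B(p,N)=\{a_1\omega+\dots+a_{p-1}\omega^{p-1}: a_j\in[-N,N]\cap\mathbb{Z}\}$ and $\mathcal V(p,N)=\{a_1\omega+\dots+a_{p-1}\omega^{p-1}: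 a_j\in\{-N,N\}\}$ (so $\#\mathcal V(p,N)=2^{p-1}$). *)

theory Defs
  imports
    "HOL-Analysis.Analysis"
    "HOL-Algebra.Generated_Fields"
    "HOL-Algebra.Algebraic_Closure_Type"
begin

definition zeta :: "nat \<Rightarrow> complex" where
  "zeta p = exp (2 * of_real pi * \<i> / of_nat p)"

definition cyclotomic_field :: "nat \<Rightarrow> complex set" where
  "cyclotomic_field p = generate_field ring_of_type_algebra (\<rat> \<union> {zeta p})"

definition cyclotomic_ring :: "nat \<Rightarrow> complex ring" where
  "cyclotomic_ring p = ring_of_type_algebra \<lparr>carrier := cyclotomic_field p\<rparr>"

text \<open>
  HOL functions are total, so an automorphism of the field is represented by the unique map that
  is \<^const>\<open>undefined\<close> outside it. Without this normalisation, each automorphism would correspond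
  to infinitely many functions, and the sum defining the trace would be 0.
\<close>
definition galois_group :: "nat \<Rightarrow> (complex \<Rightarrow> complex) set" where
  "galois_group p =
     {\<sigma> \<in> extensional (cyclotomic_field p).
        \<sigma> \<in> ring_iso (cyclotomic_ring p) (cyclotomic_ring p) \<and> (\<forall>q\<in>\<rat>. \<sigma> q = q)}"

definition field_trace :: "nat \<Rightarrow> complex \<Rightarrow> complex" where
  "field_trace p \<gamma> = (\<Sum>\<sigma>\<in>galois_group p. \<sigma> \<gamma>)"

text \<open>
  Vectors of length \<open>p - 1\<close> are functions on \<open>{1..p-1}\<close>. Their entries are rational numbers
  embedded in \<open>\<complex>\<close>, so the Euclidean norm uses the complex modulus as absolute value.
\<close>
definition trace_vec :: "nat \<Rightarrow> complex \<Rightarrow> nat \<Rightarrow> complex" where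
  "trace_vec p \<gamma> j = field_trace p (\<gamma> * zeta p ^ j)"

definition trace_norm :: "nat \<Rightarrow> complex \<Rightarrow> real" where
  "trace_norm p \<gamma> = L2_set (\<lambda>j. cmod (trace_vec p \<gamma> j)) {1..p-1}"

definition trace_dist :: "nat \<Rightarrow> complex \<Rightarrow> complex \<Rightarrow> real" where
  "trace_dist p \<alpha> \<beta> = trace_norm p (\<beta> - \<alpha>)"

definition normalized_dist :: "nat \<Rightarrow> int \<Rightarrow> complex \<Rightarrow> complex \<Rightarrow> real" where
  "normalized_dist p N \<alpha> \<beta> =
     trace_dist p \<alpha> \<beta> / (2 * of_int N * of_nat p * sqrt (of_nat p - 1))"

definition cyc_box :: "nat \<Rightarrow> int \<Rightarrow> complex set" where
  "cyc_box p N =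
     {(\<Sum>j=1..p-1. of_int (a j) * zeta p ^ j) | a :: nat \<Rightarrow> int.
        \<forall>j\<in>{1..p-1}. a j \<in> {-N..N}}"

definition cyc_vertices :: "nat \<Rightarrow> int \<Rightarrow> complex set" where
  "cyc_vertices p N =
     {(\<Sum>j=1..p-1. of_int (a j) * zeta p ^ j) | a :: nat \<Rightarrow> int.
        \<forall>j\<in>{1..p-1}. a j \<in> {-N, N}}"

end

(*
  The number c_1 w + ... + c_(p-1) w^(p-1) has squared trace norm p^2 * sum c_j^2 - (p + 1) * (sum c_j)^2.
  For fixed alpha with coefficients a_j and a random vertex with coefficients N s_j, put n = p - 1 and
  x_j = a_j / N. The squared normalized distance is then a constant (depending on alpha) plus
  a combination of U = sum x_j s_j and T = sum s_j that is bounded by (|U| + 3 |T|) / (2 n). As E U^2 <= n and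
  E T^2 = n, Chebyshev's inequality gives concentration at failure probability O(1 / n), uniformly in N and alpha.
  The trace formula needs the full Galois group, hence the irreducibility of the p-th cyclotomic
  polynomial, which comes from Eisenstein's criterion applied to ((X + 1)^p - 1) / X.
*)
theory Submission
  imports Defs "HOL-Number_Theory.Cong"
begin

section \<open>Irreducibility of the prime cyclotomic polynomial\<close>

lemma not_dvd_coeff_mult_at_first:
  fixes f g :: "int poly"
  assumes p: "Factorial_Ring.prime_elem p"
    and f: "\<And>i. i < k \<Longrightarrow> p dvd Polynomial.coeff f i" "\<not> p dvd Polynomial.coeff f k"
    and g: "\<not> p dvd Polynomial.coeff g 0"
  shows "\<not> p dvd Polynomial.coeff (f * g) k"
proof
  assume dvd: "p dvd Polynomial.coeff (f * g) k"
  have "Polynomial.coeff (f * g) k =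
      (\<Sum>i<k. Polynomial.coeff f i * Polynomial.coeff g (k - i)) + Polynomial.coeff f k * Polynomial.coeff g 0"
    by (simp add: coeff_mult lessThan_Suc_atMost [symmetric])
  moreover have "p dvd (\<Sum>i<k. Polynomial.coeff f i * Polynomial.coeff g (k - i))"
    by (intro dvd_sum dvd_mult2) (use f in auto)
  ultimately have "p dvd Polynomial.coeff f k * Polynomial.coeff g 0"
    using dvd by (simp add: dvd_add_right_iff)
  with p f(2) g show False
    by (auto simp: prime_elem_dvd_mult_iff)
qed

text \<open>Let \<open>k\<close> be the first index at which \<open>p\<close> does not divide the
  coefficient of \<open>f\<close>. Modulo \<open>p\<close> the product then also starts at
  \<open>k\<close>, since the constant term of \<open>g\<close> survives. By \<open>low\<close> this
  forces \<open>k\<close> up to the degree of the product, while \<open>k\<close> is at most the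
  degree of \<open>f\<close>; nothing is left for \<open>g\<close>.\<close>

lemma eisenstein_not_dvd_constant:
  fixes f g :: "int poly"
  assumes p: "Factorial_Ring.prime_elem p"
    and low: "\<And>i. i < Polynomial.degree (f * g) \<Longrightarrow> p dvd Polynomial.coeff (f * g) i"
    and lead: "\<not> p dvd Polynomial.lead_coeff (f * g)"
    and g: "\<not> p dvd Polynomial.coeff g 0"
  shows "Polynomial.degree g = 0"
proof -
  have nz: "f \<noteq> 0" "g \<noteq> 0" using lead by auto
  have "\<not> p dvd Polynomial.coeff f (Polynomial.degree f)"
    using lead by (auto simp: lead_coeff_mult)
  then have ex: "\<exists>k. \<not> p dvd Polynomial.coeff f k" ..
  define k where "k = (LEAST k. \<not> p dvd Polynomial.coeff f k)"
  have k: "\<not> p dvd Polynomial.coeff f k" "\<And>i. i < k \<Longrightarrow> p dvd Polynomial.coeff f i"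
    unfolding k_def using LeastI_ex[OF ex] not_less_Least by blast+
  have "\<not> p dvd Polynomial.coeff (f * g) k"
    using not_dvd_coeff_mult_at_first[OF p k(2,1) g] by blast
  then have "Polynomial.degree (f * g) \<le> k" using low not_less by blast
  moreover have "k \<le> Polynomial.degree f"
    using k(1) by (intro le_degree) auto
  ultimately show ?thesis by (simp add: degree_mult_eq nz)
qed

text \<open>If \<open>p\<close> divided both constant terms, \<open>p ^ 2\<close> would divide their
  product. So one factor has a constant term prime to \<open>p\<close>, and that factor has degree
  0.\<close>

lemma eisenstein:
  fixes f g :: "int poly"
  assumes p: "Factorial_Ring.prime_elem p"
    and low: "\<And>i. i < Polynomial.degree (f * g) \<Longrightarrow> p dvd Polynomial.coeff (f * g) i"
    and lead: "\<not> p dvd Polynomial.lead_coeff (f * g)"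
    and const: "\<not> p ^ 2 dvd Polynomial.coeff (f * g) 0"
  shows "Polynomial.degree f = 0 \<or> Polynomial.degree g = 0"
proof -
  have "\<not> (p dvd Polynomial.coeff f 0 \<and> p dvd Polynomial.coeff g 0)"
    using const by (auto simp: coeff_mult power2_eq_square intro: mult_dvd_mono)
  then consider "\<not> p dvd Polynomial.coeff g 0" | "\<not> p dvd Polynomial.coeff f 0" by blast
  then show ?thesis
  proof cases
    case 1
    then show ?thesis using eisenstein_not_dvd_constant[of p f g] p low lead by simp
  next
    case 2
    then show ?thesis using eisenstein_not_dvd_constant[of p g f] p low lead by (simp add: mult.commute)
  qed
qed

section \<open>Gauss's lemma: from rational to integer factorizations\<close>

lemma map_poly_add_hom:
  assumes "h 0 = 0" "\<And>x y. h (x + y) = h x + h y"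
  shows "map_poly h (f + g) = map_poly h f + map_poly h g"
  by (rule poly_eqI) (simp add: coeff_map_poly assms)

lemma map_poly_mult_hom:
  fixes h :: "'a::comm_semiring_0 \<Rightarrow> 'b::comm_semiring_0"
  assumes "h 0 = 0" "\<And>x y. h (x + y) = h x + h y" "\<And>x y. h (x * y) = h x * h y"
  shows "map_poly h (f * g) = map_poly h f * map_poly h g"
proof (induction f)
  case (pCons a f)
  then show ?case
    by (simp add: map_poly_pCons map_poly_smult map_poly_add_hom assms)
qed simp

lemma rat_poly_clear_denominators:
  fixes f :: "rat poly"
  obtains d :: int and F :: "int poly"
  where "d \<noteq> 0" "Polynomial.smult (of_int d) f = map_poly of_int F"
proof -
  have "\<exists>d F. d \<noteq> 0 \<and> Polynomial.smult (of_int d) f = map_poly of_int F"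
  proof (induction f)
    case 0
    show ?case by (rule exI[of _ 1], rule exI[of _ 0]) auto
  next
    case (pCons a f)
    then obtain d F where dF: "d \<noteq> 0" "Polynomial.smult (of_int d) f = map_poly of_int F" by blast
    obtain n m where nm: "m > 0" "a = of_int n / of_int m"
      by (metis quotient_of_denom_pos quotient_of_div surj_pair)
    have "Polynomial.smult (of_int (m * d)) (pCons a f) = map_poly of_int (pCons (n * d) (Polynomial.smult m F))"
    proof -
      have "Polynomial.smult (of_int (m * d)) f = Polynomial.smult (of_int m) (map_poly of_int F)"
        unfolding dF(2)[symmetric] by simp
      then show ?thesis using nm
        by (simp add: map_poly_pCons map_poly_smult)
    qed
    moreover have "m * d \<noteq> 0" using dF(1) nm(1) by simp
    ultimately show ?case by blast
  qed
  then show ?thesis using that by blast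
qed

text \<open>After clearing denominators, \<open>F * G\<close> is \<open>a * b\<close> times the
  primitive polynomial \<open>P\<close>. Content is multiplicative, so the contents of
  \<open>F\<close> and \<open>G\<close> account for all of \<open>a * b\<close> up to sign, and the
  primitive parts multiply to \<open>P\<close> up to that sign.\<close>

lemma gauss_lemma_rat:
  fixes P :: "int poly" and f g :: "rat poly"
  assumes P: "content P = 1" and fg: "f * g = map_poly of_int P"
  obtains F G :: "int poly"
  where "F * G = P" "Polynomial.degree F = Polynomial.degree f" "Polynomial.degree G = Polynomial.degree g"
proof -
  obtain a F where F: "a \<noteq> 0" "Polynomial.smult (of_int a) f = map_poly of_int F"
    by (rule rat_poly_clear_denominators)
  obtain b G where G: "b \<noteq> 0" "Polynomial.smult (of_int b) g = map_poly of_int G"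
    by (rule rat_poly_clear_denominators)
  have degF: "Polynomial.degree F = Polynomial.degree f"
  proof -
    have "Polynomial.degree F = Polynomial.degree (map_poly of_int F :: rat poly)"
      by (rule degree_map_poly [symmetric]) auto
    also have "\<dots> = Polynomial.degree f"
      using F(1) by (subst F(2) [symmetric]) simp
    finally show ?thesis .
  qed
  have degG: "Polynomial.degree G = Polynomial.degree g"
  proof -
    have "Polynomial.degree G = Polynomial.degree (map_poly of_int G :: rat poly)"
      by (rule degree_map_poly [symmetric]) auto
    also have "\<dots> = Polynomial.degree g"
      using G(1) by (subst G(2) [symmetric]) simp
    finally show ?thesis .
  qed
  have "map_poly of_int (F * G) = (map_poly of_int (Polynomial.smult (a * b) P) :: rat poly)"
    by (simp add: map_poly_mult_hom map_poly_smult mult.commute flip: F(2) G(2) fg)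
  then have eq: "F * G = Polynomial.smult (a * b) P"
    by (simp add: poly_eq_iff coeff_map_poly flip: of_int_mult)
  then have "content F * content G = \<bar>a * b\<bar>"
    using P by (metis content_mult content_smult mult.right_neutral normalize_int_def)
  \<comment> \<open>Contents are nonnegative whereas \<open>a * b\<close> may be negative; the lost
    sign is put back into the first factor.\<close>
  define s where "s = sgn (a * b)"
  have s: "s * \<bar>a * b\<bar> = a * b"
    unfolding s_def by (rule sgn_mult_abs)
  have s': "s * s = 1" "s \<noteq> 0"
    using F(1) G(1) by (auto simp: s_def sgn_if)
  have "Polynomial.smult (\<bar>a * b\<bar>) (primitive_part F * primitive_part G) = F * G"
    unfolding \<open>content F * content G = _\<close> [symmetric]
    by (metis content_times_primitive_part mult_smult_left mult_smult_right smult_smult)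
  also have "\<dots> = Polynomial.smult \<bar>a * b\<bar> (Polynomial.smult s P)"
    unfolding eq using s by (simp add: mult.commute)
  finally have "primitive_part F * primitive_part G = Polynomial.smult s P"
    using F(1) G(1) by (simp add: poly_eq_iff)
  then have "Polynomial.smult s (primitive_part F) * primitive_part G = P"
    using s'(1) by simp
  moreover have "Polynomial.degree (Polynomial.smult s (primitive_part F)) = Polynomial.degree f"
    using s'(2) degF by simp
  moreover have "Polynomial.degree (primitive_part G) = Polynomial.degree g" using degG by simp
  ultimately show ?thesis using that by blast
qed

text \<open>For prime \<open>p\<close> this is ((X + 1)^p - 1) / X, the p-th cyclotomic polynomial
  evaluated at X + 1. Giving it by its binomial coefficients makes divisibility by \<open>p\<close>
  directly readable.\<close>

definition shifted_cyclotomic :: "nat \<Rightarrow> int poly" where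
  "shifted_cyclotomic p = (\<Sum>i<p. Polynomial.monom (int (p choose Suc i)) i)"

lemma coeff_shifted_cyclotomic:
  "Polynomial.coeff (shifted_cyclotomic p) i = (if i < p then int (p choose Suc i) else 0)"
  by (simp add: shifted_cyclotomic_def coeff_sum)

lemma degree_shifted_cyclotomic:
  assumes "p > 0"
  shows "Polynomial.degree (shifted_cyclotomic p) = p - 1"
  using assms by (intro antisym degree_le le_degree) (auto simp: coeff_shifted_cyclotomic)

text \<open>Being monic, the polynomial has content 1, so Gauss's lemma moves the factorization to
  the integers. Eisenstein applies at \<open>p\<close>: the inner binomial coefficients are
  divisible by \<open>p\<close>, the leading one is 1 and the constant one is \<open>p\<close>
  itself.\<close>

lemma shifted_cyclotomic_no_factor:
  fixes f g :: "rat poly"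
  assumes p: "Factorial_Ring.prime p" and fg: "f * g = map_poly of_int (shifted_cyclotomic p)"
  shows "Polynomial.degree f = 0 \<or> Polynomial.degree g = 0"
proof -
  have p0: "p > 0" "p > 1" using p prime_gt_0_nat prime_gt_1_nat by blast+
  have deg: "Polynomial.degree (shifted_cyclotomic p) = p - 1"
    by (rule degree_shifted_cyclotomic) (use p0 in auto)
  have lead: "Polynomial.lead_coeff (shifted_cyclotomic p) = 1"
    using p0 by (simp add: deg coeff_shifted_cyclotomic)
  have "content (shifted_cyclotomic p) dvd 1"
    unfolding lead [symmetric] by (rule content_dvd_coeff)
  then have "content (shifted_cyclotomic p) = 1"
    by (metis is_unit_content_iff)
  then obtain F G :: "int poly" where FG: "F * G = shifted_cyclotomic p"
    "Polynomial.degree F = Polynomial.degree f" "Polynomial.degree G = Polynomial.degree g"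
    using gauss_lemma_rat[OF _ fg] by metis
  have "Polynomial.degree F = 0 \<or> Polynomial.degree G = 0"
  proof (rule eisenstein[of "int p"])
    show "Factorial_Ring.prime_elem (int p)" using p by simp
    show "int p dvd Polynomial.coeff (F * G) i" if "i < Polynomial.degree (F * G)" for i
      using that dvd_choose_prime[of "Suc i" p] p p0
      by (auto simp: FG(1) deg coeff_shifted_cyclotomic simp flip: int_dvd_int_iff)
    show "\<not> int p dvd Polynomial.lead_coeff (F * G)"
      using p0 by (simp add: FG(1) lead)
    show "\<not> (int p)\<^sup>2 dvd Polynomial.coeff (F * G) 0"
      using p0 by (auto simp: FG(1) coeff_shifted_cyclotomic power2_eq_square dest: zdvd_imp_le)
  qed
  with FG show ?thesis by simp
qed

text \<open>Elements of the cyclotomic field are handled as values of rational polynomials at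
  \<open>zeta p\<close>; an automorphism then only changes the point of evaluation.\<close>

definition rat_eval :: "rat poly \<Rightarrow> complex \<Rightarrow> complex" where
  "rat_eval f x = poly (map_poly of_rat f) x"

lemma rat_eval_simps [simp]:
  "rat_eval 0 x = 0" "rat_eval 1 x = 1" "rat_eval (pCons a f) x = of_rat a + x * rat_eval f x"
  "rat_eval (f + g) x = rat_eval f x + rat_eval g x"
  "rat_eval (f * g) x = rat_eval f x * rat_eval g x"
  "rat_eval (- f) x = - rat_eval f x"
  "rat_eval (f - g) x = rat_eval f x - rat_eval g x"
proof -
  show "rat_eval 0 x = 0" "rat_eval 1 x = 1" "rat_eval (pCons a f) x = of_rat a + x * rat_eval f x"
    by (simp_all add: rat_eval_def map_poly_pCons)
  show a: "rat_eval (f + g) x = rat_eval f x + rat_eval g x" for f g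
    by (simp add: rat_eval_def map_poly_add_hom of_rat_add)
  show m: "rat_eval (f * g) x = rat_eval f x * rat_eval g x" for f g
    by (simp add: rat_eval_def map_poly_mult_hom of_rat_add of_rat_mult)
  show n: "rat_eval (- f) x = - rat_eval f x" for f
    using m[of "[:-1:]" f] by (simp add: rat_eval_def map_poly_pCons of_rat_minus)
  show "rat_eval (f - g) x = rat_eval f x - rat_eval g x"
    unfolding diff_conv_add_uminus by (simp only: a n)
qed

lemma rat_eval_pcompose: "rat_eval (pcompose f g) x = rat_eval f (rat_eval g x)"
  by (induction f) (simp_all add: pcompose_pCons)

text \<open>Multiplying by the nonzero factor \<xi> - 1 turns the value into the binomial expansion
  of ((\<xi> - 1) + 1)^p without its term of index 0, that is, into \<xi>^p - 1 = 0.\<close>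

lemma rat_eval_shifted_cyclotomic:
  assumes "\<xi> ^ p = 1" "\<xi> \<noteq> 1"
  shows "rat_eval (map_poly of_int (shifted_cyclotomic p)) (\<xi> - 1) = 0"
proof -
  have 1: "map_poly of_rat (map_poly of_int (shifted_cyclotomic p)) =
      (\<Sum>i<p. Polynomial.monom (of_nat (p choose Suc i)) i :: complex poly)"
    by (rule poly_eqI) (simp add: coeff_map_poly coeff_shifted_cyclotomic coeff_sum)
  have "(\<xi> - 1) * rat_eval (map_poly of_int (shifted_cyclotomic p)) (\<xi> - 1) =
      (\<Sum>i<p. of_nat (p choose Suc i) * (\<xi> - 1) ^ Suc i)"
    by (simp add: rat_eval_def 1 poly_sum poly_monom sum_distrib_left mult_ac)
  also have "\<dots> = (\<Sum>i\<le>p. of_nat (p choose i) * (\<xi> - 1) ^ i) - 1"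
    by (simp add: sum.atMost_shift)
  also have "\<dots> = ((\<xi> - 1) + 1) ^ p - 1"
    by (subst binomial_ring) simp
  finally show ?thesis using assms by simp
qed

text \<open>Bezout's identity for the shifted \<open>f\<close> and the irreducible polynomial
  \<open>P\<close>. Since \<open>f\<close> does not vanish at \<xi>, the cofactor \<open>e\<close>
  of the gcd in \<open>P\<close> must vanish at \<xi> - 1, so \<open>e\<close> is not constant and
  the gcd is. The resulting \<open>g\<close> inverts \<open>f\<close> at every nontrivial p-th root
  of unity at once, which serves both for inverses in the field and for conjugacy of the
  roots.\<close>

lemma rat_eval_inverse:
  assumes p: "Factorial_Ring.prime p" and \<xi>: "\<xi> ^ p = 1" "\<xi> \<noteq> 1" and f: "rat_eval f \<xi> \<noteq> 0"
  obtains g where "\<And>\<eta>. \<eta> ^ p = 1 \<Longrightarrow> \<eta> \<noteq> 1 \<Longrightarrow> rat_eval g \<eta> * rat_eval f \<eta> = 1"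
proof -
  define P where "P = (map_poly of_int (shifted_cyclotomic p) :: rat poly)"
  have root: "rat_eval P (\<eta> - 1) = 0" if "\<eta> ^ p = 1" "\<eta> \<noteq> 1" for \<eta>
    using rat_eval_shifted_cyclotomic that by (simp add: P_def)
  define h where "h = pcompose f [:1, 1:]"
  have h: "rat_eval h (x - 1) = rat_eval f x" for x
    by (simp add: h_def rat_eval_pcompose)
  obtain u v where uv: "u * h + v * P = gcd h P"
    using bezout_coefficients_fst_snd by blast
  obtain e where e: "gcd h P * e = P" by (metis gcd_dvd2 dvd_def)
  obtain h' where h': "gcd h P * h' = h" by (metis gcd_dvd1 dvd_def)
  have "rat_eval (gcd h P) (\<xi> - 1) \<noteq> 0"
    using f h[of \<xi>] h' by (metis mult_zero_left rat_eval_simps(5))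
  then have e0: "rat_eval e (\<xi> - 1) = 0"
    using root[OF \<xi>] e by (metis mult_eq_0_iff rat_eval_simps(5))
  have "P \<noteq> 0"
    using degree_shifted_cyclotomic[of p] coeff_shifted_cyclotomic[of p 0] p
    by (auto simp: P_def poly_eq_iff coeff_map_poly dest: prime_gt_0_nat intro!: exI[of _ 0])
  have "Polynomial.degree e \<noteq> 0"
  proof
    assume "Polynomial.degree e = 0"
    then obtain c where "e = [:c:]" by (rule degree_eq_zeroE)
    with e0 e \<open>P \<noteq> 0\<close> show False by auto
  qed
  then have "Polynomial.degree (gcd h P) = 0"
    using shifted_cyclotomic_no_factor[OF p, of "gcd h P" e, folded P_def, OF e] by simp
  then obtain c where c: "gcd h P = [:c:]" by (rule degree_eq_zeroE)
  have "c \<noteq> 0" using c e \<open>P \<noteq> 0\<close> by auto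
  \<comment> \<open>Dividing by the constant gcd \<open>c\<close> normalizes the Bezout coefficient,
    and substituting X - 1 undoes the shift.\<close>
  define g where "g = pcompose ([:1 / c:] * u) [:-1, 1:]"
  show ?thesis
  proof
    fix \<eta> :: complex assume \<eta>: "\<eta> ^ p = 1" "\<eta> \<noteq> 1"
    have "rat_eval u (\<eta> - 1) * rat_eval f \<eta> = of_rat c"
      using arg_cong[OF uv, of "\<lambda>f. rat_eval f (\<eta> - 1)"] root[OF \<eta>] by (simp add: c h)
    moreover have "rat_eval g \<eta> = of_rat (1 / c) * rat_eval u (\<eta> - 1)"
      by (simp add: g_def rat_eval_pcompose del: mult_pCons_left)
    ultimately show "rat_eval g \<eta> * rat_eval f \<eta> = 1"
      using \<open>c \<noteq> 0\<close> by (simp add: of_rat_divide)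
  qed
qed

text \<open>Were the value at \<eta> nonzero, the polynomial inverse found at \<eta> would also
  invert the value 0 at \<xi>. This is what makes the map sending one root to another well
  defined.\<close>

lemma rat_eval_zero_conjugate:
  assumes "Factorial_Ring.prime p" "\<xi> ^ p = 1" "\<xi> \<noteq> 1" "\<eta> ^ p = 1" "\<eta> \<noteq> 1"
    and "rat_eval f \<xi> = 0"
  shows "rat_eval f \<eta> = 0"
proof (rule ccontr)
  assume "rat_eval f \<eta> \<noteq> 0"
  then show False
    using rat_eval_inverse[of p \<eta> f] assms by (metis mult_zero_right zero_neq_one)
qed

section \<open>The Galois group and the trace form\<close>

lemma zeta_power: "zeta p ^ j = exp (2 * of_real pi * \<i> * of_nat j / of_nat p)"
  unfolding zeta_def exp_of_nat_mult [symmetric] by (simp add: mult_ac)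

lemma zeta_power_eq_iff: "p > 0 \<Longrightarrow> zeta p ^ j = zeta p ^ k \<longleftrightarrow> [j = k] (mod p)"
  using complex_root_unity_eq[of p j k] by (simp add: zeta_power cong_def)

lemma zeta_power_eq_1_iff: "p > 0 \<Longrightarrow> zeta p ^ j = 1 \<longleftrightarrow> p dvd j"
  using zeta_power_eq_iff[of p j 0] by (simp add: cong_0_iff)

lemma root_of_unity_eq_zeta_power:
  assumes "p > 0" "z ^ p = 1"
  obtains k where "k < p" "z = zeta p ^ k"
  using complex_roots_unity[of p] assms by (auto simp: zeta_power)

lemma rat_eval_monom [simp]: "rat_eval (Polynomial.monom a n) x = of_rat a * x ^ n"
  by (simp add: rat_eval_def map_poly_monom poly_monom)

lemma rat_eval_sum [simp]: "rat_eval (\<Sum>i\<in>A. f i) x = (\<Sum>i\<in>A. rat_eval (f i) x)"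
  by (induction A rule: infinite_finite_induct) auto

lemma ring_of_type_algebra_simps [simp]:
  "carrier ring_of_type_algebra = UNIV"
  "x \<otimes>\<^bsub>ring_of_type_algebra\<^esub> y = x * y"
  "x \<oplus>\<^bsub>ring_of_type_algebra\<^esub> y = x + y"
  "\<one>\<^bsub>ring_of_type_algebra\<^esub> = 1"
  "\<zero>\<^bsub>ring_of_type_algebra\<^esub> = 0"
  by (simp_all add: ring_of_type_algebra_def)

lemma a_inv_ring_of_type_algebra:
  "\<ominus>\<^bsub>ring_of_type_algebra\<^esub> x = - (x :: 'a::comm_ring_1)"
proof -
  interpret ring "ring_of_type_algebra :: 'a ring" by (rule ring_from_type_algebra)
  show ?thesis by (rule minus_equality) auto
qed

lemma m_inv_ring_of_type_algebra:
  assumes "x \<noteq> 0"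
  shows "inv\<^bsub>ring_of_type_algebra\<^esub> x = inverse (x :: 'a::Fields.field)"
proof -
  interpret cring "ring_of_type_algebra :: 'a ring" by (rule cring_from_type_algebra)
  show ?thesis by (rule comm_inv_char) (use assms in auto)
qed

section \<open>The cyclotomic field and its automorphism group\<close>

context
  fixes p :: nat
  assumes p: "Factorial_Ring.prime p"
begin

lemma p_gt: "p > 0" "p > 1" "Suc 0 < p"
  using prime_gt_0_nat[OF p] prime_gt_1_nat[OF p] by auto

lemma zeta_power_conjugate: "k \<in> {1..p - 1} \<Longrightarrow> (zeta p ^ k) ^ p = 1 \<and> zeta p ^ k \<noteq> 1"
  using p_gt by (auto simp: zeta_power_eq_1_iff power_mult [symmetric] dest: dvd_imp_le)

lemma zeta_root: "zeta p ^ p = 1" "zeta p \<noteq> 1"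
  using zeta_power_conjugate[of 1] p_gt by auto

text \<open>Polynomial values are closed under the field operations, inverses being supplied by
  \<open>rat_eval_inverse\<close>. Conversely, Horner's scheme builds each value inside the
  generated field.\<close>

lemma cyclotomic_field_eq: "cyclotomic_field p = range (\<lambda>f. rat_eval f (zeta p))"
proof (intro equalityI subsetI)
  fix x assume "x \<in> cyclotomic_field p"
  then show "x \<in> range (\<lambda>f. rat_eval f (zeta p))"
    unfolding cyclotomic_field_def
  proof induction
    case one
    then show ?case by (auto intro: range_eqI[of _ _ 1])
  next
    case (incl h)
    then show ?case
      by (auto elim!: Rats_cases intro: range_eqI[of _ _ "[:_:]"] range_eqI[of _ _ "[:0, 1:]"])
  next
    case (a_inv h)
    then show ?case
      by (auto simp: a_inv_ring_of_type_algebra intro: range_eqI[of _ _ "- _"])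
  next
    case (m_inv h)
    then obtain f where f: "h = rat_eval f (zeta p)" "rat_eval f (zeta p) \<noteq> 0" by auto
    obtain g where "rat_eval g (zeta p) * rat_eval f (zeta p) = 1"
      using rat_eval_inverse[OF p zeta_root f(2)] zeta_root by metis
    then have "inverse h = rat_eval g (zeta p)"
      unfolding f(1) by (simp add: inverse_unique mult.commute)
    with f show ?case by (auto simp: m_inv_ring_of_type_algebra)
  next
    case (eng_add h1 h2)
    then show ?case by (auto intro: range_eqI[of _ _ "_ + _"])
  next
    case (eng_mult h1 h2)
    then show ?case by (auto intro: range_eqI[of _ _ "_ * _"])
  qed
next
  have "rat_eval f (zeta p) \<in> cyclotomic_field p" for f
  proof (induction f)
    case 0
    then show ?case
      using generate_field.incl[of 0 "\<rat> \<union> {zeta p}" ring_of_type_algebra]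
      by (simp add: cyclotomic_field_def)
  next
    case (pCons a f)
    then show ?case
      using generate_field.incl[of "of_rat a" "\<rat> \<union> {zeta p}" ring_of_type_algebra]
        generate_field.incl[of "zeta p" "\<rat> \<union> {zeta p}" ring_of_type_algebra]
        generate_field.eng_mult[of "zeta p" ring_of_type_algebra "\<rat> \<union> {zeta p}"]
        generate_field.eng_add[of "of_rat a" ring_of_type_algebra "\<rat> \<union> {zeta p}"]
      by (simp add: cyclotomic_field_def)
  qed
  then show "x \<in> cyclotomic_field p" if "x \<in> range (\<lambda>f. rat_eval f (zeta p))" for x
    using that by auto
qed

text \<open>The automorphism sending \<open>zeta p\<close> to its k-th power, for k from 1 to p - 1.
  A field element has many representing polynomials, hence the choice; the restricted abstraction
  meets the extensionality required by \<open>galois_group\<close>.\<close>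

definition conjugation :: "nat \<Rightarrow> complex \<Rightarrow> complex" where
  "conjugation k = (\<lambda>x\<in>cyclotomic_field p.
     rat_eval (SOME f. rat_eval f (zeta p) = x) (zeta p ^ k))"

lemma rat_eval_eq_conjugate:
  assumes "\<xi> ^ p = 1" "\<xi> \<noteq> 1" "\<eta> ^ p = 1" "\<eta> \<noteq> 1" "rat_eval f \<xi> = rat_eval g \<xi>"
  shows "rat_eval f \<eta> = rat_eval g \<eta>"
  using rat_eval_zero_conjugate[OF p assms(1-4), of "f - g"] assms(5) by simp

text \<open>The choice in \<open>conjugation\<close> is harmless: polynomials that agree at
  \<open>zeta p\<close> agree at every nontrivial p-th root of unity.\<close>

lemma conjugation_rat_eval:
  assumes "k \<in> {1..p - 1}"
  shows "conjugation k (rat_eval f (zeta p)) = rat_eval f (zeta p ^ k)"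
proof -
  have "rat_eval (SOME g. rat_eval g (zeta p) = rat_eval f (zeta p)) (zeta p) = rat_eval f (zeta p)"
    by (rule someI) (rule refl)
  then have "rat_eval (SOME g. rat_eval g (zeta p) = rat_eval f (zeta p)) (zeta p ^ k) = rat_eval f (zeta p ^ k)"
    using zeta_root zeta_power_conjugate[OF assms] by (blast intro: rat_eval_eq_conjugate)
  moreover have "rat_eval f (zeta p) \<in> cyclotomic_field p" by (simp add: cyclotomic_field_eq)
  ultimately show ?thesis by (simp add: conjugation_def)
qed

text \<open>The homomorphism laws are those of polynomial evaluation. Injectivity transfers equality
  from the k-th power back to \<open>zeta p\<close>.\<close>

lemma conjugation_in_galois_group:
  assumes k: "k \<in> {1..p - 1}"
  shows "conjugation k \<in> galois_group p"
proof -
  note [simp] = conjugation_rat_eval[OF k]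
  have iso: "conjugation k \<in> ring_iso (cyclotomic_ring p) (cyclotomic_ring p)"
  proof (rule ring_iso_memI)
    show "conjugation k x \<in> carrier (cyclotomic_ring p)" if x: "x \<in> carrier (cyclotomic_ring p)" for x
    proof -
      obtain f where "x = rat_eval f (zeta p)"
        using x by (auto simp: cyclotomic_ring_def cyclotomic_field_eq)
      then show ?thesis
        by (auto simp: cyclotomic_ring_def cyclotomic_field_eq rat_eval_pcompose
            intro!: range_eqI[of _ _ "pcompose f (Polynomial.monom 1 k)"])
    qed
    fix x y assume "x \<in> carrier (cyclotomic_ring p)" "y \<in> carrier (cyclotomic_ring p)"
    then obtain f g where fg: "x = rat_eval f (zeta p)" "y = rat_eval g (zeta p)"
      by (auto simp: cyclotomic_ring_def cyclotomic_field_eq)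
    show "conjugation k (x \<otimes>\<^bsub>cyclotomic_ring p\<^esub> y) = conjugation k x \<otimes>\<^bsub>cyclotomic_ring p\<^esub> conjugation k y"
      using conjugation_rat_eval[OF k, of "f * g"] fg by (simp add: cyclotomic_ring_def)
    show "conjugation k (x \<oplus>\<^bsub>cyclotomic_ring p\<^esub> y) = conjugation k x \<oplus>\<^bsub>cyclotomic_ring p\<^esub> conjugation k y"
      using conjugation_rat_eval[OF k, of "f + g"] fg by (simp add: cyclotomic_ring_def)
  next
    show "conjugation k \<one>\<^bsub>cyclotomic_ring p\<^esub> = \<one>\<^bsub>cyclotomic_ring p\<^esub>"
      using conjugation_rat_eval[OF k, of 1] by (simp add: cyclotomic_ring_def)
  next
    have "inj_on (conjugation k) (cyclotomic_field p)"
    proof (rule inj_onI)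
      fix x y assume xy: "x \<in> cyclotomic_field p" "y \<in> cyclotomic_field p" "conjugation k x = conjugation k y"
      then obtain f g where fg: "x = rat_eval f (zeta p)" "y = rat_eval g (zeta p)"
        by (auto simp: cyclotomic_field_eq)
      have "rat_eval f (zeta p ^ k) = rat_eval g (zeta p ^ k)"
        using xy(3) fg by simp
      then show "x = y"
        unfolding fg using zeta_root zeta_power_conjugate[OF k] by (blast intro: rat_eval_eq_conjugate)
    qed
    moreover have "conjugation k ` cyclotomic_field p = cyclotomic_field p"
    proof (intro equalityI subsetI)
      fix y assume "y \<in> conjugation k ` cyclotomic_field p"
      then obtain f where "y = rat_eval f (zeta p ^ k)" by (auto simp: cyclotomic_field_eq)
      then show "y \<in> cyclotomic_field p"
        by (auto simp: cyclotomic_field_eq rat_eval_pcompose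
            intro!: range_eqI[of _ _ "pcompose f (Polynomial.monom 1 k)"])
    next
      fix y assume "y \<in> cyclotomic_field p"
      then obtain f where f: "y = rat_eval f (zeta p)" by (auto simp: cyclotomic_field_eq)
      \<comment> \<open>Surjectivity: with \<open>m\<close> inverse to \<open>k\<close> modulo
        \<open>p\<close>, substituting X^m into \<open>f\<close> yields a preimage of
        \<open>y\<close>.\<close>
      have "\<not> p dvd k" using k by (auto dest: dvd_imp_le)
      then have "coprime k p" using p by (metis prime_imp_coprime coprime_commute)
      then obtain m where m: "[k * m = 1] (mod p)" using cong_solve_coprime_nat by (metis One_nat_def)
      have "(zeta p ^ k) ^ m = zeta p"
        using m p_gt zeta_power_eq_iff[of p "k * m" 1] by (simp add: power_mult)
      then have "rat_eval (pcompose f (Polynomial.monom 1 m)) (zeta p ^ k) = y"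
        by (simp add: rat_eval_pcompose f)
      then have "conjugation k (rat_eval (pcompose f (Polynomial.monom 1 m)) (zeta p)) = y"
        by (simp only: conjugation_rat_eval[OF k])
      then show "y \<in> conjugation k ` cyclotomic_field p"
        by (metis cyclotomic_field_eq rangeI image_eqI)
    qed
    ultimately show "bij_betw (conjugation k) (carrier (cyclotomic_ring p)) (carrier (cyclotomic_ring p))"
      by (simp add: bij_betw_def cyclotomic_ring_def)
  qed
  have "conjugation k q = q" if "q \<in> \<rat>" for q
  proof -
    obtain a where "q = of_rat a" using \<open>q \<in> \<rat>\<close> by (rule Rats_cases)
    then show ?thesis using conjugation_rat_eval[OF k, of "[:a:]"] by simp
  qed
  with iso show ?thesis by (auto simp: galois_group_def conjugation_def)
qed

text \<open>An automorphism fixing the rationals commutes with rational polynomials, so it is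
  determined by the image of \<open>zeta p\<close>. That image is again a p-th root of unity, and
  injectivity keeps it different from 1.\<close>

lemma galois_group_eq: "galois_group p = conjugation ` {1..p - 1}"
proof (intro equalityI subsetI)
  fix \<sigma> assume \<sigma>: "\<sigma> \<in> galois_group p"
  then have iso: "\<sigma> \<in> ring_iso (cyclotomic_ring p) (cyclotomic_ring p)"
    and ext: "\<sigma> \<in> extensional (cyclotomic_field p)" and rat: "\<And>q. \<sigma> (of_rat q) = of_rat q"
    by (auto simp: galois_group_def)
  have zeta: "zeta p \<in> cyclotomic_field p"
    using rangeI[of "\<lambda>f. rat_eval f (zeta p)" "[:0, 1:]"] by (simp add: cyclotomic_field_eq)
  have ev: "rat_eval f (zeta p) \<in> cyclotomic_field p" for f by (simp add: cyclotomic_field_eq)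
  have rats: "of_rat q \<in> cyclotomic_field p" for q
    using ev[of "[:q:]"] by simp
  have mem: "zeta p * rat_eval f (zeta p) \<in> cyclotomic_field p" for f
    using ev[of "[:0, 1:] * f"] by simp
  have hom: "\<sigma> (x + y) = \<sigma> x + \<sigma> y" "\<sigma> (x * y) = \<sigma> x * \<sigma> y"
    if "x \<in> cyclotomic_field p" "y \<in> cyclotomic_field p" for x y
    using ring_iso_memE(2,3)[OF iso] that by (simp_all add: cyclotomic_ring_def)
  have inj: "inj_on \<sigma> (cyclotomic_field p)"
    using ring_iso_memE(5)[OF iso] by (simp add: cyclotomic_ring_def bij_betw_def)
  have \<sigma>_eval: "\<sigma> (rat_eval f (zeta p)) = rat_eval f (\<sigma> (zeta p))" for f
  proof (induction f)
    case 0
    then show ?case using rat[of 0] by simp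
  next
    case (pCons a f)
    then show ?case by (simp add: hom zeta ev rats mem rat)
  qed
  have "\<sigma> (zeta p) ^ p = 1"
    using \<sigma>_eval[of "Polynomial.monom 1 p"] zeta_root rat[of 1] by simp
  then obtain k where k: "k < p" "\<sigma> (zeta p) = zeta p ^ k"
    using root_of_unity_eq_zeta_power p_gt(1) by metis
  have "\<sigma> (zeta p) \<noteq> 1"
    using inj_onD[OF inj, of "zeta p" 1] rat[of 1] rats[of 1] zeta zeta_root by auto
  with k have k': "k \<in> {1..p - 1}" by (cases k) auto
  have "\<sigma> = conjugation k"
  proof (rule extensionalityI[OF ext])
    show "conjugation k \<in> extensional (cyclotomic_field p)" by (simp add: conjugation_def)
    show "\<sigma> x = conjugation k x" if "x \<in> cyclotomic_field p" for x
      using that \<sigma>_eval k(2) conjugation_rat_eval[OF k'] by (auto simp: cyclotomic_field_eq)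
  qed
  with k' show "\<sigma> \<in> conjugation ` {1..p - 1}" by blast
qed (auto intro: conjugation_in_galois_group)

lemma inj_on_conjugation: "inj_on conjugation {1..p - 1}"
proof (rule inj_onI)
  fix j k assume jk: "j \<in> {1..p - 1}" "k \<in> {1..p - 1}" "conjugation j = conjugation k"
  have "zeta p ^ j = zeta p ^ k"
    using conjugation_rat_eval[OF jk(1), of "[:0, 1:]"] conjugation_rat_eval[OF jk(2), of "[:0, 1:]"] jk(3)
    by simp
  with jk p_gt show "j = k" by (auto simp: zeta_power_eq_iff cong_def)
qed

section \<open>The trace form in coordinates\<close>

lemma field_trace_rat_eval:
  "field_trace p (rat_eval f (zeta p)) = (\<Sum>k=1..p-1. rat_eval f (zeta p ^ k))"
  unfolding field_trace_def galois_group_eq sum.reindex[OF inj_on_conjugation]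
  by (intro sum.cong) (simp_all add: conjugation_rat_eval)

text \<open>When \<open>p\<close> does not divide \<open>m\<close>, the geometric sum over all k < p
  vanishes; removing the term 1 at k = 0 leaves -1.\<close>

lemma sum_zeta_powers:
  "(\<Sum>k=1..p-1. zeta p ^ (k * m)) = (if p dvd m then of_nat p - 1 else - 1)"
proof (cases "p dvd m")
  case True
  then have "zeta p ^ (k * m) = 1" for k using p_gt by (simp add: zeta_power_eq_1_iff)
  with True p_gt show ?thesis by (simp add: of_nat_diff)
next
  case False
  have "(\<Sum>k<p. (zeta p ^ m) ^ k) = 0"
    using False p_gt by (subst geometric_sum) (auto simp: zeta_power_eq_1_iff simp flip: power_mult)
  moreover have "{..<p} = insert 0 {1..p-1}" using p_gt by auto
  ultimately have "1 + (\<Sum>k=1..p-1. (zeta p ^ m) ^ k) = 0" by simp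
  with False show ?thesis
    by (simp add: add_eq_0_iff mult.commute flip: power_mult)
qed

text \<open>The trace of the power \<open>j + i\<close> of \<open>zeta p\<close> is p - 1 if
  \<open>p\<close> divides \<open>j + i\<close> and -1 otherwise. Writing p - 1 as p + (-1)
  separates the single index \<open>p - i\<close> from the full coefficient sum.\<close>

lemma trace_vec_int_combination:
  fixes c :: "nat \<Rightarrow> int"
  assumes i: "i \<in> {1..p - 1}"
  shows "trace_vec p (\<Sum>j=1..p-1. of_int (c j) * zeta p ^ j) i = of_int (int p * c (p - i) - (\<Sum>j=1..p-1. c j))"
proof -
  define f where "f = (\<Sum>j=1..p-1. Polynomial.monom (of_int (c j)) (j + i) :: rat poly)"
  have f: "rat_eval f x = (\<Sum>j=1..p-1. of_int (c j) * x ^ (j + i))" for x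
    by (simp add: f_def)
  have "trace_vec p (\<Sum>j=1..p-1. of_int (c j) * zeta p ^ j) i = field_trace p (rat_eval f (zeta p))"
    by (simp add: trace_vec_def f sum_distrib_right power_add mult.assoc)
  also have "\<dots> = (\<Sum>k=1..p-1. \<Sum>j=1..p-1. of_int (c j) * zeta p ^ (k * (j + i)))"
    by (subst field_trace_rat_eval) (simp only: f power_mult)
  also have "\<dots> = (\<Sum>j=1..p-1. of_int (c j) * (if p dvd j + i then of_nat p - 1 else - 1))"
    by (subst sum.swap) (simp only: sum_distrib_left [symmetric] sum_zeta_powers)
  also have "\<dots> = (\<Sum>j=1..p-1. (if j = p - i then of_nat p * of_int (c j) else 0) - of_int (c j))"
  proof (intro sum.cong refl)
    fix j assume j: "j \<in> {1..p-1}"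
    \<comment> \<open>Both indices lie between 1 and p - 1, so \<open>p\<close> is the only multiple
      of \<open>p\<close> their sum can equal.\<close>
    have "p dvd j + i \<longleftrightarrow> j = p - i"
    proof
      assume "p dvd j + i"
      then obtain q where q: "j + i = p * q" ..
      moreover have "0 < j + i" "j + i < p * 2" using i j by auto
      ultimately have "0 < p * q" "p * q < p * 2" by simp_all
      then have "q = 1" by (cases q) auto
      with q show "j = p - i" by simp
    qed (use i in auto)
    then show "of_int (c j) * (if p dvd j + i then of_nat p - 1 else - 1) =
        (if j = p - i then of_nat p * of_int (c j) else 0) - (of_int (c j) :: complex)"
      by (simp add: algebra_simps)
  qed
  also have "\<dots> = of_nat p * of_int (c (p - i)) - (\<Sum>j=1..p-1. of_int (c j))"
    using i by (auto simp: sum_subtractf)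
  finally show ?thesis by simp
qed

text \<open>After the reversal of indices, the squares of p c_j - S are summed. The mixed terms
  contribute -2 p S^2 and the constant ones (p - 1) S^2, together -(p + 1) S^2.\<close>

lemma trace_norm_int_combination:
  fixes c :: "nat \<Rightarrow> int"
  shows "(trace_norm p (\<Sum>j=1..p-1. of_int (c j) * zeta p ^ j))\<^sup>2 =
    real p ^ 2 * (\<Sum>j=1..p-1. (real_of_int (c j))\<^sup>2) - (real p + 1) * (\<Sum>j=1..p-1. real_of_int (c j))\<^sup>2"
proof -
  define S where "S = (\<Sum>j=1..p-1. real_of_int (c j))"
  have "(trace_norm p (\<Sum>j=1..p-1. of_int (c j) * zeta p ^ j))\<^sup>2 =
      (\<Sum>i=1..p-1. (cmod (of_int (int p * c (p - i) - (\<Sum>j=1..p-1. c j))))\<^sup>2)"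
    unfolding trace_norm_def L2_set_def
    by (subst real_sqrt_pow2)
       (auto intro!: sum_nonneg sum.cong simp only: trace_vec_int_combination zero_le_power2)
  also have "\<dots> = (\<Sum>i=1..p-1. (p * c (p - i) - S)\<^sup>2)"
    unfolding norm_of_int by (simp add: S_def)
  also have "\<dots> = (\<Sum>j=1..p-1. (p * c j - S)\<^sup>2)"
    by (rule sum.reindex_bij_witness[of _ "\<lambda>j. p - j" "\<lambda>j. p - j"]) auto
  also have "\<dots> = (\<Sum>j=1..p-1. real p ^ 2 * (real_of_int (c j))\<^sup>2 - 2 * real p * S * c j + S\<^sup>2)"
    by (intro sum.cong refl) (simp add: power2_eq_square algebra_simps)
  also have "\<dots> = real p ^ 2 * (\<Sum>j=1..p-1. (real_of_int (c j))\<^sup>2) - 2 * real p * S * S + real (p - 1) * S\<^sup>2"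
    by (simp add: sum.distrib sum_subtractf S_def flip: sum_distrib_left)
  also have "\<dots> = real p ^ 2 * (\<Sum>j=1..p-1. (real_of_int (c j))\<^sup>2) - (real p + 1) * S\<^sup>2"
    using p_gt by (simp add: of_nat_diff algebra_simps power2_eq_square)
  finally show ?thesis unfolding S_def .
qed

text \<open>Linear independence read off from the trace: a zero trace vector gives p c_j = S for
  every j, and summing over j gives p S = (p - 1) S, so S = 0. It is used to count the
  vertices.\<close>

lemma int_combination_eq_0D:
  fixes c :: "nat \<Rightarrow> int"
  assumes "(\<Sum>j=1..p-1. of_int (c j) * zeta p ^ j) = 0" "j \<in> {1..p - 1}"
  shows "c j = 0"
proof -
  define S where "S = (\<Sum>j=1..p-1. c j)"
  have *: "int p * c j = S" if "j \<in> {1..p - 1}" for j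
  proof -
    have "p - j \<in> {1..p - 1}" "p - (p - j) = j" using that by auto
    moreover have "trace_vec p 0 (p - j) = 0"
      using field_trace_rat_eval[of 0] by (simp add: trace_vec_def)
    ultimately have "of_int (int p * c j - S) = (0 :: complex)"
      using trace_vec_int_combination[of "p - j" c] assms(1) by (simp add: S_def)
    then show ?thesis by (simp only: of_int_eq_0_iff)
  qed
  have "int p * S = (\<Sum>j=1..p-1. int p * c j)" by (simp add: S_def sum_distrib_left)
  also have "\<dots> = (\<Sum>j=1..p-1. S)" using * by (intro sum.cong) auto
  also have "\<dots> = (int p - 1) * S" using p_gt by (simp add: of_nat_diff)
  finally have "S = 0" by (simp add: algebra_simps)
  with *[OF assms(2)] p_gt show ?thesis by simp
qed

end

section \<open>Concentration of sums of random signs\<close>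

text \<open>Sign vectors on a finite set A are encoded as subsets, so an expectation over
  independent uniform signs is a sum over \<open>Pow A\<close> divided by
  \<open>2 ^ card A\<close>.\<close>

definition sign_of :: "'a set \<Rightarrow> 'a \<Rightarrow> real" where
  "sign_of B i = (if i \<in> B then 1 else - 1)"

lemma sum_Pow_insert:
  fixes f :: "'a set \<Rightarrow> 'b::comm_monoid_add"
  assumes "finite A" "a \<notin> A"
  shows "(\<Sum>B\<in>Pow (insert a A). f B) = (\<Sum>B\<in>Pow A. f B + f (insert a B))"
proof -
  have "inj_on (insert a) (Pow A)"
    using assms by (auto intro!: inj_onI)
  moreover have "Pow A \<inter> insert a ` Pow A = {}" using assms by auto
  ultimately show ?thesis
    using assms by (simp add: Pow_insert sum.union_disjoint sum.reindex sum.distrib)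
qed

text \<open>The second moment of a shifted sum of random signs. The free constant \<open>c\<close>
  drives the induction: the sign of a new element \<open>a\<close> replaces \<open>c\<close> by c -
  x a or c + x a, and the cross terms cancel.\<close>

lemma sum_Pow_signed_square:
  fixes x :: "'a \<Rightarrow> real"
  assumes "finite A"
  shows "(\<Sum>B\<in>Pow A. (c + (\<Sum>i\<in>A. x i * sign_of B i))\<^sup>2) = 2 ^ card A * (c\<^sup>2 + (\<Sum>i\<in>A. (x i)\<^sup>2))"
  using assms
proof (induction A arbitrary: c)
  case empty
  then show ?case by simp
next
  case (insert a A)
  have 1: "(\<Sum>i\<in>A. x i * sign_of (insert a B) i) = (\<Sum>i\<in>A. x i * sign_of B i)" for B
    using insert(2) by (intro sum.cong) (auto simp: sign_of_def)
  have "(\<Sum>B\<in>Pow (insert a A). (c + (\<Sum>i\<in>insert a A. x i * sign_of B i))\<^sup>2) =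
      (\<Sum>B\<in>Pow A. ((c - x a) + (\<Sum>i\<in>A. x i * sign_of B i))\<^sup>2 + ((c + x a) + (\<Sum>i\<in>A. x i * sign_of B i))\<^sup>2)"
    unfolding sum_Pow_insert[OF insert(1,2)]
  proof (intro sum.cong refl)
    fix B assume "B \<in> Pow A"
    then have "a \<notin> B" using insert(2) by auto
    then show "(c + (\<Sum>i\<in>insert a A. x i * sign_of B i))\<^sup>2 + (c + (\<Sum>i\<in>insert a A. x i * sign_of (insert a B) i))\<^sup>2 =
      ((c - x a) + (\<Sum>i\<in>A. x i * sign_of B i))\<^sup>2 + ((c + x a) + (\<Sum>i\<in>A. x i * sign_of B i))\<^sup>2"
      using insert(1,2) by (simp add: 1) (simp add: sign_of_def algebra_simps)
  qed
  also have "\<dots> = 2 ^ card A * ((c - x a)\<^sup>2 + (\<Sum>i\<in>A. (x i)\<^sup>2)) + 2 ^ card A * ((c + x a)\<^sup>2 + (\<Sum>i\<in>A. (x i)\<^sup>2))"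
    unfolding sum.distrib by (simp only: insert.IH)
  also have "\<dots> = 2 ^ card (insert a A) * (c\<^sup>2 + (\<Sum>i\<in>insert a A. (x i)\<^sup>2))"
    using insert(1,2) by (simp add: algebra_simps power2_eq_square)
  finally show ?case .
qed

section \<open>From second moments to counts of deviating pairs\<close>

lemma chebyshev_counting:
  fixes f :: "'a \<Rightarrow> real"
  assumes "finite S" "t > 0"
  shows "t\<^sup>2 * real (card {s\<in>S. \<bar>f s\<bar> > t}) \<le> (\<Sum>s\<in>S. (f s)\<^sup>2)"
proof -
  have "t\<^sup>2 * real (card {s\<in>S. \<bar>f s\<bar> > t}) = (\<Sum>s\<in>{s\<in>S. \<bar>f s\<bar> > t}. t\<^sup>2)" by simp
  also have "\<dots> \<le> (\<Sum>s\<in>{s\<in>S. \<bar>f s\<bar> > t}. (f s)\<^sup>2)"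
    using assms(2) by (intro sum_mono) (auto simp: abs_le_square_iff [symmetric])
  also have "\<dots> \<le> (\<Sum>s\<in>S. (f s)\<^sup>2)"
    using assms(1) by (intro sum_mono2) auto
  finally show ?thesis .
qed

text \<open>Subadditivity of the square root. It passes from squared distances to distances with no
  lower bound on the distances.\<close>

lemma abs_sqrt_diff_le:
  assumes "x \<ge> 0" "y \<ge> 0"
  shows "\<bar>sqrt x - sqrt y\<bar> \<le> sqrt \<bar>x - y\<bar>"
proof -
  have "sqrt x \<le> sqrt y + sqrt (x - y)" if "y \<le> x" "y \<ge> 0" for x y :: real
    using sqrt_add_le_add_sqrt[of y "x - y"] that by simp
  from this[of x y] this[of y x] assms show ?thesis
    by (cases "y \<le> x") (auto simp: abs_if)
qed

text \<open>With X and T the sums of \<open>x\<close> and \<open>s\<close>, and U the sum of the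
  products, s_i^2 = 1 reduces the difference to -U / (2n) + \<kappa> T (2X - T). Only U and T depend
  linearly on the signs; the remaining factor is bounded trivially.\<close>

lemma deviation_bound:
  fixes x s :: "'a \<Rightarrow> real"
  assumes A: "finite A" "card A = n" "n > 0"
    and x: "\<And>i. i \<in> A \<Longrightarrow> \<bar>x i\<bar> \<le> 1" and s: "\<And>i. i \<in> A \<Longrightarrow> \<bar>s i\<bar> = 1"
    and \<kappa>: "0 \<le> \<kappa>" "\<kappa> \<le> 1 / (2 * (real n)\<^sup>2)"
  shows "\<bar>((\<Sum>i\<in>A. (s i - x i)\<^sup>2) / (4 * n) - \<kappa> * (\<Sum>i\<in>A. s i - x i)\<^sup>2) -
      ((n + (\<Sum>i\<in>A. (x i)\<^sup>2)) / (4 * n) - \<kappa> * (\<Sum>i\<in>A. x i)\<^sup>2)\<bar>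
    \<le> (\<bar>\<Sum>i\<in>A. x i * s i\<bar> + 3 * \<bar>\<Sum>i\<in>A. s i\<bar>) / (2 * n)"
proof -
  define xs where "xs = (\<Sum>i\<in>A. x i)"
  define ss where "ss = (\<Sum>i\<in>A. s i)"
  define xss where "xss = (\<Sum>i\<in>A. x i * s i)"
  have xs: "\<bar>xs\<bar> \<le> n"
    unfolding xs_def using sum_bounded_above[of A "\<lambda>i. \<bar>x i\<bar>" 1] x A
    by (intro order_trans[OF sum_abs]) simp
  have ss: "\<bar>ss\<bar> \<le> n"
    unfolding ss_def using sum_bounded_above[of A "\<lambda>i. \<bar>s i\<bar>" 1] s A
    by (intro order_trans[OF sum_abs]) simp
  have sq: "(s i)\<^sup>2 = 1" if "i \<in> A" for i
    using s[OF that] by (metis power2_abs one_power2)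
  have "(\<Sum>i\<in>A. (s i - x i)\<^sup>2) = (\<Sum>i\<in>A. 1 + (x i)\<^sup>2 - 2 * (x i * s i))"
    by (intro sum.cong refl) (simp add: power2_diff sq)
  also have "\<dots> = n + (\<Sum>i\<in>A. (x i)\<^sup>2) - 2 * xss"
    using A by (simp add: xss_def sum.distrib sum_subtractf sum_distrib_left)
  finally have 1: "(\<Sum>i\<in>A. (s i - x i)\<^sup>2) = n + (\<Sum>i\<in>A. (x i)\<^sup>2) - 2 * xss" .
  have 2: "(\<Sum>i\<in>A. s i - x i) = ss - xs" by (simp add: sum_subtractf ss_def xs_def)
  have "((\<Sum>i\<in>A. (s i - x i)\<^sup>2) / (4 * n) - \<kappa> * (\<Sum>i\<in>A. s i - x i)\<^sup>2) -
      ((n + (\<Sum>i\<in>A. (x i)\<^sup>2)) / (4 * n) - \<kappa> * (\<Sum>i\<in>A. x i)\<^sup>2) = - xss / (2 * n) + \<kappa> * ss * (2 * xs - ss)"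
    unfolding 1 2 xs_def [symmetric] using A(3) by (simp add: field_simps power2_eq_square)
  also have "\<bar>\<dots>\<bar> \<le> \<bar>xss\<bar> / (2 * n) + \<bar>\<kappa> * ss * (2 * xs - ss)\<bar>"
    by (rule order_trans[OF abs_triangle_ineq]) simp
  also have "\<bar>\<kappa> * ss * (2 * xs - ss)\<bar> = \<kappa> * (\<bar>ss\<bar> * \<bar>2 * xs - ss\<bar>)"
    using \<kappa> by (simp add: abs_mult)
  \<comment> \<open>Both \<open>xs\<close> and \<open>ss\<close> are at most \<open>n\<close> in
    absolute value, whence the factor \<open>3 * n\<close>.\<close>
  also have "\<dots> \<le> 1 / (2 * (real n)\<^sup>2) * (\<bar>ss\<bar> * (3 * n))"
    using xs ss \<kappa> by (intro mult_mono) auto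
  also have "\<dots> = 3 * \<bar>ss\<bar> / (2 * n)"
    using A(3) by (simp add: field_simps power2_eq_square)
  finally show ?thesis
    unfolding xss_def ss_def by (simp add: add_divide_distrib)
qed

text \<open>Two values more than \<open>2 * \<delta>\<close> apart cannot both lie within \<delta>
  of \<open>M\<close>. Chebyshev bounds the proportion of subsets with a deviation above \<delta> by
  5 / (n \<delta>^2), and either member of the pair may be the bad one, which doubles it.\<close>

lemma card_deviating_pairs:
  fixes F :: "'a set \<Rightarrow> real" and x :: "'a \<Rightarrow> real"
  assumes A: "finite A" "card A = n" "n > 0" and \<delta>: "\<delta> > 0"
    and x: "\<And>i. i \<in> A \<Longrightarrow> \<bar>x i\<bar> \<le> 1"
    and dev: "\<And>B. B \<subseteq> A \<Longrightarrow> \<bar>F B - M\<bar> \<le> (\<bar>\<Sum>i\<in>A. x i * sign_of B i\<bar> + 3 * \<bar>\<Sum>i\<in>A. sign_of B i\<bar>) / (2 * n)"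
  shows "real (card {(B, C) \<in> Pow A \<times> Pow A. \<bar>F B - F C\<bar> > 2 * \<delta>}) \<le> (2 ^ n)\<^sup>2 * (10 / (n * \<delta>\<^sup>2))"
proof -
  define bad where "bad = {B\<in>Pow A. \<bar>F B - M\<bar> > \<delta>}"
  have "\<delta>\<^sup>2 * real (card bad) \<le> (\<Sum>B\<in>Pow A. (F B - M)\<^sup>2)"
    unfolding bad_def using A \<delta> by (intro chebyshev_counting) auto
  also have "\<dots> \<le> (\<Sum>B\<in>Pow A. ((\<Sum>i\<in>A. x i * sign_of B i)\<^sup>2 + 9 * (\<Sum>i\<in>A. 1 * sign_of B i)\<^sup>2) / (2 * (real n)\<^sup>2))"
  proof (intro sum_mono)
    fix B assume B: "B \<in> Pow A"
    define u where "u = \<bar>\<Sum>i\<in>A. x i * sign_of B i\<bar>"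
    define v where "v = \<bar>\<Sum>i\<in>A. sign_of B i\<bar>"
    have "(F B - M)\<^sup>2 \<le> ((u + 3 * v) / (2 * n))\<^sup>2"
      using dev[of B] B by (subst abs_le_square_iff [symmetric]) (simp add: u_def v_def)
    also have "\<dots> = (u + 3 * v)\<^sup>2 / (4 * (real n)\<^sup>2)"
      by (simp add: power_divide power_mult_distrib)
    \<comment> \<open>The squares of u + 3v and u - 3v add up to 2 (u^2 + 9 v^2); this separates the
      two sign sums.\<close>
    also have "\<dots> \<le> 2 * (u\<^sup>2 + 9 * v\<^sup>2) / (4 * (real n)\<^sup>2)"
      using zero_le_power2[of "u - 3 * v"]
      by (intro divide_right_mono) (simp_all add: power2_eq_square algebra_simps)
    finally show "(F B - M)\<^sup>2 \<le> ((\<Sum>i\<in>A. x i * sign_of B i)\<^sup>2 + 9 * (\<Sum>i\<in>A. 1 * sign_of B i)\<^sup>2) / (2 * (real n)\<^sup>2)"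
      by (simp add: u_def v_def add_divide_distrib)
  qed
  \<comment> \<open>The explicit 0 and 1 bring both sums into the shape of
    \<open>sum_Pow_signed_square\<close>.\<close>
  also have "\<dots> = ((\<Sum>B\<in>Pow A. (0 + (\<Sum>i\<in>A. x i * sign_of B i))\<^sup>2) +
      9 * (\<Sum>B\<in>Pow A. (0 + (\<Sum>i\<in>A. 1 * sign_of B i))\<^sup>2)) / (2 * (real n)\<^sup>2)"
    by (simp add: sum.distrib sum_distrib_left flip: sum_divide_distrib)
  also have "\<dots> = 2 ^ n * ((\<Sum>i\<in>A. (x i)\<^sup>2) + 9 * n) / (2 * (real n)\<^sup>2)"
    unfolding sum_Pow_signed_square[OF A(1)] using A by (simp add: algebra_simps)
  also have "\<dots> \<le> 2 ^ n * (n + 9 * n) / (2 * (real n)\<^sup>2)"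
  proof -
    have "(\<Sum>i\<in>A. (x i)\<^sup>2) \<le> (\<Sum>i\<in>A. 1)"
      using x by (intro sum_mono) (simp add: abs_square_le_1)
    then show ?thesis using A by (intro divide_right_mono mult_left_mono) auto
  qed
  also have "\<dots> = 2 ^ n * (5 / n)" using A(3) by (simp add: field_simps power2_eq_square)
  finally have bad: "real (card bad) \<le> 2 ^ n * (5 / (n * \<delta>\<^sup>2))"
    using \<delta> A(3) by (simp add: field_simps)
  have fin: "finite bad" "finite (Pow A)" using A by (auto simp: bad_def)
  have "{(B, C) \<in> Pow A \<times> Pow A. \<bar>F B - F C\<bar> > 2 * \<delta>} \<subseteq> bad \<times> Pow A \<union> Pow A \<times> bad"
    by (auto simp: bad_def)
  then have "card {(B, C) \<in> Pow A \<times> Pow A. \<bar>F B - F C\<bar> > 2 * \<delta>} \<le> card (bad \<times> Pow A \<union> Pow A \<times> bad)"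
    using fin by (intro card_mono) auto
  also have "\<dots> \<le> card bad * 2 ^ n + 2 ^ n * card bad"
    using card_Un_le[of "bad \<times> Pow A" "Pow A \<times> bad"] A by (simp add: card_cartesian_product card_Pow)
  finally have "real (card {(B, C) \<in> Pow A \<times> Pow A. \<bar>F B - F C\<bar> > 2 * \<delta>}) \<le> real (2 * 2 ^ n * card bad)"
    unfolding of_nat_le_iff by (simp only: mult.commute mult_2 mult.assoc distrib_left)
  also have "\<dots> \<le> 2 * 2 ^ n * (2 ^ n * (5 / (n * \<delta>\<^sup>2)))"
    using mult_left_mono[OF bad, of "2 * 2 ^ n"] by simp
  finally show ?thesis by (simp add: power2_eq_square mult_ac)
qed

section \<open>Distances to the vertices\<close>

definition vertex :: "nat \<Rightarrow> int \<Rightarrow> nat set \<Rightarrow> complex" where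
  "vertex p N B = (\<Sum>j=1..p-1. of_int (if j \<in> B then N else - N) * zeta p ^ j)"

lemma cyc_vertices_eq: "cyc_vertices p N = vertex p N ` Pow {1..p - 1}"
proof (intro equalityI subsetI)
  fix \<beta> assume "\<beta> \<in> cyc_vertices p N"
  then obtain a :: "nat \<Rightarrow> int" where a: "\<beta> = (\<Sum>j=1..p-1. of_int (a j) * zeta p ^ j)"
    "\<forall>j\<in>{1..p-1}. a j \<in> {-N, N}"
    unfolding cyc_vertices_def by blast
  have "\<beta> = vertex p N {j\<in>{1..p-1}. a j = N}"
    unfolding a(1) vertex_def using a(2) by (intro sum.cong) auto
  then show "\<beta> \<in> vertex p N ` Pow {1..p - 1}" by blast
next
  fix \<beta> assume "\<beta> \<in> vertex p N ` Pow {1..p - 1}"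
  then obtain B where "\<beta> = vertex p N B" by blast
  then show "\<beta> \<in> cyc_vertices p N"
    unfolding cyc_vertices_def vertex_def
    by (intro CollectI exI[of _ "\<lambda>j. if j \<in> B then N else - N"]) simp
qed

text \<open>Equal vertices have a difference with zero coefficients by linear independence, and as
  \<open>N\<close> is nonzero a coefficient vanishes only where the two subsets agree.\<close>

lemma inj_on_vertex:
  assumes p: "Factorial_Ring.prime p" and N: "N \<noteq> 0"
  shows "inj_on (vertex p N) (Pow {1..p - 1})"
proof (rule inj_onI)
  fix B C assume BC: "B \<in> Pow {1..p - 1}" "C \<in> Pow {1..p - 1}" "vertex p N B = vertex p N C"
  define c where "c j = (if j \<in> B then N else - N) - (if j \<in> C then N else - N)" for j
  have "(\<Sum>j=1..p-1. of_int (c j) * zeta p ^ j) = vertex p N B - vertex p N C"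
    by (simp add: c_def vertex_def algebra_simps flip: sum_subtractf)
  then have c0: "c j = 0" if "j \<in> {1..p - 1}" for j
    using int_combination_eq_0D[OF p _ that] BC(3) by simp
  have "j \<in> B \<longleftrightarrow> j \<in> C" if "j \<in> {1..p - 1}" for j
    using c0[OF that] N by (auto simp: c_def split: if_splits)
  with BC(1,2) show "B = C" by blast
qed

lemma card_cyc_vertices:
  assumes "Factorial_Ring.prime p" "N \<noteq> 0"
  shows "card (cyc_vertices p N) = 2 ^ (p - 1)"
  unfolding cyc_vertices_eq card_image[OF inj_on_vertex[OF assms]] by (simp add: card_Pow)

text \<open>Scaling the coordinates of \<alpha> by 1 / N extracts N^2 from the squared trace norm,
  where it cancels against the normalization. This makes the later bounds uniform in
  \<open>N\<close>.\<close>

lemma normalized_dist_vertex: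
  fixes a :: "nat \<Rightarrow> int"
  assumes p: "Factorial_Ring.prime p" and N: "N \<ge> 1"
    and \<alpha>: "\<alpha> = (\<Sum>j=1..p-1. of_int (a j) * zeta p ^ j)"
  defines "x \<equiv> \<lambda>j. real_of_int (a j) / real_of_int N"
  shows "(normalized_dist p N \<alpha> (vertex p N B))\<^sup>2 =
    (\<Sum>j=1..p-1. (sign_of B j - x j)\<^sup>2) / (4 * real (p - 1)) -
    (real p + 1) / (4 * (real p)\<^sup>2 * real (p - 1)) * (\<Sum>j=1..p-1. sign_of B j - x j)\<^sup>2"
proof -
  have p1: "p > 1" using p by (rule prime_gt_1_nat)
  define c where "c j = (if j \<in> B then N else - N) - a j" for j
  have c: "real_of_int (c j) = N * (sign_of B j - x j)" for j
    using N by (simp add: c_def sign_of_def x_def field_simps)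
  have eq: "vertex p N B - \<alpha> = (\<Sum>j=1..p-1. of_int (c j) * zeta p ^ j)"
    by (simp add: \<alpha> vertex_def c_def algebra_simps flip: sum_subtractf)
  have "(normalized_dist p N \<alpha> (vertex p N B))\<^sup>2 =
      (trace_norm p (vertex p N B - \<alpha>))\<^sup>2 / (4 * (real_of_int N)\<^sup>2 * (real p)\<^sup>2 * (real p - 1))"
    using p1 by (simp add: normalized_dist_def trace_dist_def power_divide power_mult_distrib)
  also have "(trace_norm p (vertex p N B - \<alpha>))\<^sup>2 =
      (real_of_int N)\<^sup>2 * ((real p)\<^sup>2 * (\<Sum>j=1..p-1. (sign_of B j - x j)\<^sup>2) -
        (real p + 1) * (\<Sum>j=1..p-1. sign_of B j - x j)\<^sup>2)"
    unfolding eq trace_norm_int_combination[OF p] c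
    by (simp only: power_mult_distrib sum_distrib_left [symmetric]) (simp add: algebra_simps)
  also have "\<dots> / (4 * (real_of_int N)\<^sup>2 * (real p)\<^sup>2 * (real p - 1)) =
    (\<Sum>j=1..p-1. (sign_of B j - x j)\<^sup>2) / (4 * real (p - 1)) -
    (real p + 1) / (4 * (real p)\<^sup>2 * real (p - 1)) * (\<Sum>j=1..p-1. sign_of B j - x j)\<^sup>2"
  proof -
    \<comment> \<open>Here \<open>n\<close>, \<open>q\<close>, \<open>r\<close> stand for N^2, p^2
      and p - 1; \<open>s\<close> is the sum of squares, \<open>t\<close> is p + 1 and
      \<open>u\<close> the squared sum.\<close>
    have frac: "(n * (q * s - t * u)) / (4 * n * q * r) = s / (4 * r) - t / (4 * q * r) * u"
      if "n > 0" "q > 0" "r > 0" for n q s t u r :: real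
      using that by (simp add: field_simps)
    show ?thesis
      unfolding of_nat_diff[OF less_imp_le[OF p1]] of_nat_1 by (rule frac) (use p1 N in auto)
  qed
  finally show ?thesis .
qed

lemma normalized_dist_nonneg: "N \<ge> 0 \<Longrightarrow> p \<ge> 1 \<Longrightarrow> normalized_dist p N \<alpha> \<beta> \<ge> 0"
  by (simp add: normalized_dist_def trace_dist_def trace_norm_def)

text \<open>Distances more than \<epsilon> apart have squares more than \<epsilon>^2 apart, so the
  count for sign vectors applies to the squared distances.\<close>

lemma card_far_vertex_pairs:
  assumes p: "Factorial_Ring.prime p" and N: "N \<ge> 1" and \<alpha>: "\<alpha> \<in> cyc_box p N" and \<epsilon>: "\<epsilon> > 0"
  shows "real (card {(\<beta>1, \<beta>2) \<in> cyc_vertices p N \<times> cyc_vertices p N.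
      \<bar>normalized_dist p N \<alpha> \<beta>1 - normalized_dist p N \<alpha> \<beta>2\<bar> > \<epsilon>})
    \<le> (2 ^ (p - 1))\<^sup>2 * (40 / (real (p - 1) * \<epsilon> ^ 4))"
proof -
  have p1: "p > 1" using p by (rule prime_gt_1_nat)
  let ?A = "{1..p - 1}"
  obtain a :: "nat \<Rightarrow> int" where a: "\<alpha> = (\<Sum>j=1..p-1. of_int (a j) * zeta p ^ j)"
    "\<forall>j\<in>{1..p-1}. a j \<in> {-N..N}"
    using \<alpha> by (auto simp: cyc_box_def)
  define x where "x = (\<lambda>j. real_of_int (a j) / real_of_int N)"
  have x_eq: "real_of_int (a j) / real_of_int N = x j" for j by (simp add: x_def)
  define \<kappa> where "\<kappa> = (real p + 1) / (4 * (real p)\<^sup>2 * real (p - 1))"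
  define D where "D B = normalized_dist p N \<alpha> (vertex p N B)" for B
  define M where "M = (real (p - 1) + (\<Sum>i\<in>?A. (x i)\<^sup>2)) / (4 * real (p - 1)) - \<kappa> * (\<Sum>i\<in>?A. x i)\<^sup>2"
  have x: "\<bar>x j\<bar> \<le> 1" if "j \<in> ?A" for j
  proof -
    have "a j \<in> {-N..N}" using a(2) that by blast
    then have "\<bar>a j\<bar> \<le> N" by auto
    then have "\<bar>real_of_int (a j)\<bar> \<le> real_of_int N" by linarith
    then show ?thesis using N by (simp add: x_def abs_divide)
  qed
  have \<kappa>: "0 \<le> \<kappa>" "\<kappa> \<le> 1 / (2 * (real (p - 1))\<^sup>2)"
  proof -
    show "0 \<le> \<kappa>" by (simp add: \<kappa>_def)
    have "(real p + 1) * (2 * (real (p - 1))\<^sup>2) \<le> 4 * (real p)\<^sup>2 * real (p - 1)"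
    proof -
      \<comment> \<open>The left side is p^2 - 1; this is the bound on \<kappa> after cancelling a
        factor 2 (p - 1).\<close>
      have "(real p + 1) * real (p - 1) \<le> 2 * (real p)\<^sup>2"
        using p1 by (simp add: of_nat_diff algebra_simps power2_eq_square)
      then have "(real p + 1) * real (p - 1) * (2 * real (p - 1)) \<le> 2 * (real p)\<^sup>2 * (2 * real (p - 1))"
        by (rule mult_right_mono) simp
      then show ?thesis by (simp add: power2_eq_square mult_ac)
    qed
    then show "\<kappa> \<le> 1 / (2 * (real (p - 1))\<^sup>2)"
      unfolding \<kappa>_def using p1 by (subst divide_le_eq, simp, simp add: divide_simps mult_ac)
  qed
  have dev: "\<bar>(D B)\<^sup>2 - M\<bar> \<le> (\<bar>\<Sum>i\<in>?A. x i * sign_of B i\<bar> + 3 * \<bar>\<Sum>i\<in>?A. sign_of B i\<bar>) / (2 * real (p - 1))" for B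
    unfolding D_def M_def normalized_dist_vertex[OF p N a(1)] x_eq \<kappa>_def [symmetric]
    by (rule deviation_bound) (use p1 x \<kappa> in \<open>auto simp: sign_of_def\<close>)
  \<comment> \<open>Chosen so that \<open>2 * \<delta>\<close> is the gap \<epsilon>^2 between
    squares; it turns 10 / (n \<delta>^2) into 40 / (n \<epsilon>^4).\<close>
  define \<delta> where "\<delta> = \<epsilon>\<^sup>2 / 2"
  have \<delta>: "\<delta> > 0" using \<epsilon> by (simp add: \<delta>_def)
  let ?far = "{(\<beta>1, \<beta>2) \<in> cyc_vertices p N \<times> cyc_vertices p N.
      \<bar>normalized_dist p N \<alpha> \<beta>1 - normalized_dist p N \<alpha> \<beta>2\<bar> > \<epsilon>}"
  let ?far' = "{(B, C) \<in> Pow ?A \<times> Pow ?A. \<bar>(D B)\<^sup>2 - (D C)\<^sup>2\<bar> > 2 * \<delta>}"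
  have close: "\<bar>(D B)\<^sup>2 - (D C)\<^sup>2\<bar> > 2 * \<delta>" if "\<bar>D B - D C\<bar> > \<epsilon>" for B C
  proof -
    have "\<bar>D B - D C\<bar> \<le> sqrt \<bar>(D B)\<^sup>2 - (D C)\<^sup>2\<bar>"
      using abs_sqrt_diff_le[of "(D B)\<^sup>2" "(D C)\<^sup>2"] N p1 by (simp add: D_def normalized_dist_nonneg)
    with that have "sqrt (\<epsilon>\<^sup>2) < sqrt \<bar>(D B)\<^sup>2 - (D C)\<^sup>2\<bar>" using \<epsilon> by simp
    then show ?thesis unfolding real_sqrt_less_iff by (simp add: \<delta>_def)
  qed
  have fin: "finite ?far'" by (rule finite_subset[of _ "Pow ?A \<times> Pow ?A"]) auto
  have "?far \<subseteq> (\<lambda>(B, C). (vertex p N B, vertex p N C)) ` ?far'"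
  proof (rule subsetI, clarify)
    fix \<beta>1 \<beta>2 assume \<beta>: "\<beta>1 \<in> cyc_vertices p N" "\<beta>2 \<in> cyc_vertices p N"
      "\<bar>normalized_dist p N \<alpha> \<beta>1 - normalized_dist p N \<alpha> \<beta>2\<bar> > \<epsilon>"
    then obtain B C where BC: "B \<in> Pow ?A" "\<beta>1 = vertex p N B" "C \<in> Pow ?A" "\<beta>2 = vertex p N C"
      unfolding cyc_vertices_eq by blast
    have "(B, C) \<in> ?far'" using BC close[of B C] \<beta>(3) by (simp add: D_def)
    then show "(\<beta>1, \<beta>2) \<in> (\<lambda>(B, C). (vertex p N B, vertex p N C)) ` ?far'"
      unfolding BC(2,4) by (rule rev_image_eqI) simp
  qed
  then have "card ?far \<le> card ?far'"
    using fin by (rule surj_card_le[rotated])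
  also have "real (card ?far') \<le> (2 ^ (p - 1))\<^sup>2 * (10 / (real (p - 1) * \<delta>\<^sup>2))"
    by (rule card_deviating_pairs[where x = x and M = M]) (use p1 \<delta> x dev in auto)
  also have "10 / (real (p - 1) * \<delta>\<^sup>2) = 40 / (real (p - 1) * \<epsilon> ^ 4)"
    by (simp add: \<delta>_def power_divide)
  finally show ?thesis by simp
qed

theorem theorem1:
  shows "\<forall>\<epsilon>::real. \<epsilon> > 0 \<longrightarrow>
    (\<exists>p0::nat. Factorial_Ring.prime p0 \<and>
      (\<forall>p::nat. Factorial_Ring.prime p \<and> odd p \<and> p \<ge> p0 \<longrightarrow>
        (\<forall>N::int. N \<ge> 1 \<longrightarrow>
          (\<forall>\<alpha>\<in>cyc_box p N.
            1 / real (card (cyc_vertices p N)) ^ 2 *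
              real (card {(\<beta>1, \<beta>2) \<in> cyc_vertices p N \<times> cyc_vertices p N.
                \<bar>normalized_dist p N \<alpha> \<beta>1 - normalized_dist p N \<alpha> \<beta>2\<bar> \<le> \<epsilon>})
            \<ge> 1 - \<epsilon>))))"
proof (intro allI impI)
  fix \<epsilon> :: real assume \<epsilon>: "\<epsilon> > 0"
  \<comment> \<open>The failure proportion 40 / ((p - 1) \<epsilon>^4) is at most \<epsilon> once p
    - 1 reaches 40 / \<epsilon>^5; the added 1 accounts for the passage from \<open>p\<close> to p -
    1.\<close>
  obtain p0 where p0: "Factorial_Ring.prime p0" "p0 > nat \<lceil>40 / \<epsilon> ^ 5\<rceil> + 1"
    using bigger_prime by blast
  show "\<exists>p0::nat. Factorial_Ring.prime p0 \<and>
      (\<forall>p::nat. Factorial_Ring.prime p \<and> odd p \<and> p \<ge> p0 \<longrightarrow>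
        (\<forall>N::int. N \<ge> 1 \<longrightarrow>
          (\<forall>\<alpha>\<in>cyc_box p N.
            1 / real (card (cyc_vertices p N)) ^ 2 *
              real (card {(\<beta>1, \<beta>2) \<in> cyc_vertices p N \<times> cyc_vertices p N.
                \<bar>normalized_dist p N \<alpha> \<beta>1 - normalized_dist p N \<alpha> \<beta>2\<bar> \<le> \<epsilon>})
            \<ge> 1 - \<epsilon>)))"
  proof (intro exI[of _ p0] conjI allI impI ballI, rule p0(1))
    fix p :: nat and N :: int and \<alpha>
    assume p: "Factorial_Ring.prime p \<and> odd p \<and> p \<ge> p0" and N: "N \<ge> 1" and \<alpha>: "\<alpha> \<in> cyc_box p N"
    let ?V = "cyc_vertices p N"
    let ?near = "{(\<beta>1, \<beta>2) \<in> ?V \<times> ?V. \<bar>normalized_dist p N \<alpha> \<beta>1 - normalized_dist p N \<alpha> \<beta>2\<bar> \<le> \<epsilon>}"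
    let ?far = "{(\<beta>1, \<beta>2) \<in> ?V \<times> ?V. \<bar>normalized_dist p N \<alpha> \<beta>1 - normalized_dist p N \<alpha> \<beta>2\<bar> > \<epsilon>}"
    have prime: "Factorial_Ring.prime p" using p by blast
    have cardV: "card ?V = 2 ^ (p - 1)" using prime N by (intro card_cyc_vertices) auto
    have posV: "(real (card ?V))\<^sup>2 > 0" by (simp add: cardV)
    have finV: "finite ?V" by (simp add: cyc_vertices_eq)
    have n: "40 / \<epsilon> ^ 5 \<le> real (p - 1)" "real (p - 1) > 0"
      using p p0(2) by linarith+
    have "40 / (real (p - 1) * \<epsilon> ^ 4) \<le> \<epsilon>"
      using n \<epsilon> by (simp add: field_simps power_numeral_reduce)
    then have "(2 ^ (p - 1))\<^sup>2 * (40 / (real (p - 1) * \<epsilon> ^ 4)) \<le> (2 ^ (p - 1))\<^sup>2 * \<epsilon>"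
      by (intro mult_left_mono) auto
    then have far: "real (card ?far) \<le> (2 ^ (p - 1))\<^sup>2 * \<epsilon>"
      using card_far_vertex_pairs[OF prime N \<alpha> \<epsilon>] by (rule order_trans[rotated])
    have fin: "finite ?near" "finite ?far"
      by (rule finite_subset[of _ "?V \<times> ?V"]; use finV in auto)+
    have un: "?V \<times> ?V = ?near \<union> ?far" and disj: "?near \<inter> ?far = {}" by auto
    have "card (?V \<times> ?V) = card ?near + card ?far"
      using arg_cong[OF un, of card] card_Un_disjoint[OF fin disj] by (rule trans)
    then have "(real (card ?V))\<^sup>2 = real (card ?near) + real (card ?far)"
      unfolding card_cartesian_product by (simp add: power2_eq_square flip: of_nat_mult of_nat_add)
    with far have "(1 - \<epsilon>) * (real (card ?V))\<^sup>2 \<le> real (card ?near)"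
      by (simp add: cardV algebra_simps)
    then show "1 / real (card ?V) ^ 2 * real (card ?near) \<ge> 1 - \<epsilon>"
      using posV by (simp add: pos_le_divide_eq)
  qed
qed

end
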